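(* Every random assignment satisfying ex-ante favoring-eagerness-for-remaining-items (ea-FERI) with respect to a preference profile $R$ also satisfies sd-Pareto-efficiency (sd-PE) with respect to $R$. The converse fails: there exist an assignment problem, a preference profile, and a random assignment that satisfies sd-PE but not ea-FERI.
   Context: Setting. An assignment problem has a set $N=\{1,\dots,n\}$ of agents and a set $M$ of $n$ items (one unit each). A preference profile $R=(\succ_j)_{j\in N}$ gives each agent $j$ a strict linear order $\succ_j$ on $M$. For nonempty $S\subseteq M$, $\mathrm{top}(j,S)$ is the $\succ_j$-best item of $S$. $U(\succ_j,o)=\{o'\in M:o'\succ_jo\}\cup\{o\}$. A random assignment is a doubly stochastic $n\times n$ matrix $P=[p_{j,o}]_{j\in N,o\in M}$ with rows $P_j$. ea-FERI. Given $P$, put $M_{P,0}=\emptyset$ and $E_{P,0}(o)=\emptyset$ for all $o$. For $r=1,2,\dots$ define recursively $M_{P,r}=\{o\in M:\sum_{k\in\bigcup_{r'<r}E_{P,r'}(o)}p_{k,o}<1\}$ and, for $o\in M_{P,r}$, $E_{P,r}(o)=\{j\in N:o=\mathrm{top}(j,M_{P,r})\}$ (with $E_{P,r}(o)=\emptyset$ for $o\notin M_{P,r}$). $P$ satisfies ea-FERI if for every $r\ge1$, every $o\in M_{P,r}$ and every $j\in N$: if $j\in E_{P,r'}(o)$ for some $r'<r$, then $\sum_{o'\in U(\succ_j,o)}p_{j,o'}=1$. Stochastic dominance. For probability vectors $p,q$ on $M$, $p\succeq^{sd}_jq$ means $\sum_{o'\in U(\succ_j,o)}p_{o'}\ge\sum_{o'\in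 U(\succ_j,o)}q_{o'}$ for all $o\in M$. sd-PE: $P$ is sd-PE if there is no random assignment $Q\neq P$ with $Q_j\succeq^{sd}_jP_j$ for every $j\in N$. *)

theory Defs
  imports Complex_Main
begin

definition assignment_problem :: "'a set \<Rightarrow> 'b set \<Rightarrow> bool" where
  "assignment_problem N M \<longleftrightarrow> finite N \<and> finite M \<and> card M = card N"

text \<open>A pair (x, y) in the relation R j means that agent j strictly prefers item x to item y.\<close>

type_synonym ('a, 'b) profile = "'a \<Rightarrow> 'b rel"

definition preference_profile :: "'a set \<Rightarrow> 'b set \<Rightarrow> ('a, 'b) profile \<Rightarrow> bool" where
  "preference_profile N M R \<longleftrightarrow>
     (\<forall>j\<in>N. R j \<subseteq> M \<times> M \<and> strict_linear_order_on M (R j))"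

definition top_item :: "('a, 'b) profile \<Rightarrow> 'a \<Rightarrow> 'b set \<Rightarrow> 'b" where
  "top_item R j S = (THE x. x \<in> S \<and> (\<forall>y\<in>S. y \<noteq> x \<longrightarrow> (x, y) \<in> R j))"

definition upper_set :: "'b set \<Rightarrow> 'b rel \<Rightarrow> 'b \<Rightarrow> 'b set" where
  "upper_set M r x = {y \<in> M. (y, x) \<in> r} \<union> {x}"

definition random_assignment :: "'a set \<Rightarrow> 'b set \<Rightarrow> ('a \<Rightarrow> 'b \<Rightarrow> real) \<Rightarrow> bool" where
  "random_assignment N M P \<longleftrightarrow>
     (\<forall>j\<in>N. \<forall>x\<in>M. 0 \<le> P j x) \<and>
     (\<forall>j\<in>N. (\<Sum>x\<in>M. P j x) = 1) \<and>
     (\<forall>x\<in>M. (\<Sum>j\<in>N. P j x) = 1)"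

text \<open>
  The set of items still available in round r, and the set of agents that are eager for
  item x in round r, by mutual course-of-values recursion on r.
\<close>

function avail :: "'a set \<Rightarrow> 'b set \<Rightarrow> ('a, 'b) profile \<Rightarrow> ('a \<Rightarrow> 'b \<Rightarrow> real) \<Rightarrow> nat \<Rightarrow> 'b set"
  and eager :: "'a set \<Rightarrow> 'b set \<Rightarrow> ('a, 'b) profile \<Rightarrow> ('a \<Rightarrow> 'b \<Rightarrow> real) \<Rightarrow> nat \<Rightarrow> 'b \<Rightarrow> 'a set"
  where
    "avail N M R P r =
       (if r = 0 then {}
        else {x \<in> M. (\<Sum>k\<in>(\<Union>r'\<in>{..<r}. eager N M R P r' x). P k x) < 1})"
  | "eager N M R P r x =
       (if x \<in> avail N M R P r then {j \<in> N. x = top_item R j (avail N M R P r)} else {})"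
  by pat_completeness auto
termination
  by (relation "measure (\<lambda>z. case z of
         Inl (N, M, R, P, r) \<Rightarrow> 2 * r
       | Inr (N, M, R, P, r, x) \<Rightarrow> 2 * r + 1)") auto

declare avail.simps [simp del] eager.simps [simp del]

definition ea_FERI :: "'a set \<Rightarrow> 'b set \<Rightarrow> ('a, 'b) profile \<Rightarrow> ('a \<Rightarrow> 'b \<Rightarrow> real) \<Rightarrow> bool" where
  "ea_FERI N M R P \<longleftrightarrow>
     (\<forall>r\<ge>1. \<forall>x\<in>avail N M R P r. \<forall>j\<in>N.
        (\<exists>r'<r. j \<in> eager N M R P r' x) \<longrightarrow> (\<Sum>y\<in>upper_set M (R j) x. P j y) = 1)"

definition sd_weakly_dominates :: "'b set \<Rightarrow> 'b rel \<Rightarrow> ('b \<Rightarrow> real) \<Rightarrow> ('b \<Rightarrow> real) \<Rightarrow> bool" where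
  "sd_weakly_dominates M r p q \<longleftrightarrow>
     (\<forall>x\<in>M. (\<Sum>y\<in>upper_set M r x. p y) \<ge> (\<Sum>y\<in>upper_set M r x. q y))"

text \<open>
  Two assignments are distinct iff they differ at some entry indexed by N and M; the values of
  the representing functions elsewhere are meaningless.
\<close>

definition sd_PE :: "'a set \<Rightarrow> 'b set \<Rightarrow> ('a, 'b) profile \<Rightarrow> ('a \<Rightarrow> 'b \<Rightarrow> real) \<Rightarrow> bool" where
  "sd_PE N M R P \<longleftrightarrow>
     \<not> (\<exists>Q. random_assignment N M Q \<and> (\<exists>j\<in>N. \<exists>x\<in>M. Q j x \<noteq> P j x) \<and>
            (\<forall>j\<in>N. sd_weakly_dominates M (R j) (Q j) (P j)))"

end

theory Submission
  imports Defs
begin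

text \<open>
  Let \<open>Q\<close> dominate \<open>P\<close>. By induction on the round, \<open>Q\<close> agrees with \<open>P\<close> at every pair of an agent
  and an item for which the agent has been eager, and hence on the whole column of every exhausted
  item. Indeed, an agent eager for \<open>x\<close> prefers to \<open>x\<close> only exhausted items, so dominance gives her
  at least as much of \<open>x\<close> under \<open>Q\<close>. Equality follows from the column sum if \<open>x\<close> is exhausted in
  this round, and otherwise from the row sum, because ea-FERI then says that her items down to \<open>x\<close>
  have total probability 1. Once the set of available items is stationary, every agent is either
  satisfied in this sense or faces only exhausted items, so \<open>Q\<close> agrees with \<open>P\<close> everywhere.

  The identity assignment for the preferences \<open>0 > 1 > 2\<close>, \<open>0 > 1 > 2\<close>, \<open>1 > 0 > 2\<close> is a serial
  dictatorship, hence sd-efficient, but agent 2, the only one eager for item 1 in round 1, gets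
  item 2.
\<close>

section \<open>Best items in strict linear orders, and equality cases for finite sums\<close>

lemma top_item_eqI:
  assumes "strict_linear_order_on M (R j)" "x \<in> S" "\<And>y. y \<in> S \<Longrightarrow> y \<noteq> x \<Longrightarrow> (x, y) \<in> R j"
  shows "top_item R j S = x"
  unfolding top_item_def
proof (rule the_equality)
  fix z assume z: "z \<in> S \<and> (\<forall>y\<in>S. y \<noteq> z \<longrightarrow> (z, y) \<in> R j)"
  have tr: "trans (R j)" and irr: "irrefl (R j)"
    using assms(1) by (auto simp: strict_linear_order_on_def)
  show "z = x"
  proof (rule ccontr)
    assume "z \<noteq> x"
    then have "(z, x) \<in> R j" "(x, z) \<in> R j"
      using z assms(2,3) by auto
    then show False
      using transD[OF tr] irr unfolding irrefl_def by blast
  qed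
qed (use assms in blast)

lemma ex_top:
  assumes "strict_linear_order_on M r" "finite S" "S \<noteq> {}" "S \<subseteq> M"
  shows "\<exists>x\<in>S. \<forall>y\<in>S. y \<noteq> x \<longrightarrow> (x, y) \<in> r"
  using assms(2-)
proof (induction S rule: finite_ne_induct)
  case (singleton x)
  then show ?case by simp
next
  case (insert a S)
  then obtain x where x: "x \<in> S" "\<forall>y\<in>S. y \<noteq> x \<longrightarrow> (x, y) \<in> r" by auto
  have tr: "trans r" and tot: "total_on M r"
    using assms(1) by (auto simp: strict_linear_order_on_def)
  have "(x, a) \<in> r \<or> (a, x) \<in> r"
    using tot[unfolded total_on_def, rule_format, of x a] insert.hyps insert.prems x by auto
  then show ?case
  proof
    assume "(x, a) \<in> r"
    then show ?thesis using x by auto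
  next
    assume ax: "(a, x) \<in> r"
    have "(a, y) \<in> r" if "y \<in> S" for y
      using that x ax transD[OF tr, of a x y] by (cases "y = x") auto
    then show ?thesis by auto
  qed
qed

lemma top_item_props:
  assumes "strict_linear_order_on M (R j)" "finite S" "S \<noteq> {}" "S \<subseteq> M"
  shows "top_item R j S \<in> S"
    and "y \<in> S \<Longrightarrow> y \<noteq> top_item R j S \<Longrightarrow> (top_item R j S, y) \<in> R j"
proof -
  obtain x where x: "x \<in> S" "\<forall>y\<in>S. y \<noteq> x \<longrightarrow> (x, y) \<in> R j"
    using ex_top[OF assms] by blast
  moreover from this have "top_item R j S = x"
    by (intro top_item_eqI[where R = R, OF assms(1)]) auto
  ultimately show "top_item R j S \<in> S"
    and "y \<in> S \<Longrightarrow> y \<noteq> top_item R j S \<Longrightarrow> (top_item R j S, y) \<in> R j"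
    by auto
qed

lemma sum_eq_imp_eq_of_le:
  fixes f g :: "'c \<Rightarrow> real"
  assumes "finite A" "\<And>x. x \<in> A \<Longrightarrow> f x \<le> g x" "sum g A \<le> sum f A" "x \<in> A"
  shows "f x = g x"
  using assms sum_mono_inv[of f A g] sum_mono[of A f g] by force

lemma eq_zero_of_sum_subset:
  fixes f :: "'c \<Rightarrow> real"
  assumes "finite A" "B \<subseteq> A" "\<And>x. x \<in> A \<Longrightarrow> 0 \<le> f x" "sum f A \<le> sum f B" "x \<in> A - B"
  shows "f x = 0"
proof -
  have "sum f A = sum f (A - B) + sum f B"
    using assms sum.subset_diff by blast
  then have "sum f (A - B) = 0"
    using assms sum_nonneg[of "A - B" f] by auto
  then show ?thesis
    using assms sum_nonneg_eq_0_iff[of "A - B" f] by auto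
qed

section \<open>Monotonicity of the round recursion\<close>

definition past_eager :: "'a set \<Rightarrow> 'b set \<Rightarrow> ('a, 'b) profile \<Rightarrow> ('a \<Rightarrow> 'b \<Rightarrow> real) \<Rightarrow> nat \<Rightarrow> 'b \<Rightarrow> 'a set"
  where "past_eager N M R P r x = (\<Union>r'\<in>{..<r}. eager N M R P r' x)"

lemma avail_iff:
  "x \<in> avail N M R P r \<longleftrightarrow> r \<noteq> 0 \<and> x \<in> M \<and> (\<Sum>k\<in>past_eager N M R P r x. P k x) < 1"
  by (subst avail.simps) (auto simp: past_eager_def)

lemma eager_iff:
  "j \<in> eager N M R P r x \<longleftrightarrow>
     x \<in> avail N M R P r \<and> j \<in> N \<and> x = top_item R j (avail N M R P r)"
  by (subst eager.simps) auto

lemma past_eager_Suc: "past_eager N M R P (Suc r) x = past_eager N M R P r x \<union> eager N M R P r x"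
  by (auto simp: past_eager_def less_Suc_eq)

lemma past_eager_subset: "past_eager N M R P r x \<subseteq> N"
  by (auto simp: past_eager_def eager_iff)

lemma past_eager_one: "past_eager N M R P (Suc 0) x = {}"
  by (auto simp: past_eager_def eager_iff avail_iff)

lemma avail_subset: "avail N M R P r \<subseteq> M"
  by (auto simp: avail_iff)

lemma avail_one: "avail N M R P (Suc 0) = M"
  by (auto simp: avail_iff past_eager_one)

text \<open>Past eager agents only accumulate and \<open>P\<close> is nonnegative, so an exhausted
  item stays exhausted. Round 0 is excluded because \<open>avail\<close> is empty there, whereas
  round 1 offers all of \<open>M\<close>.\<close>

lemma avail_Suc_subset:
  assumes "finite N" "random_assignment N M P" "r \<noteq> 0"
  shows "avail N M R P (Suc r) \<subseteq> avail N M R P r"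
proof
  fix x assume x: "x \<in> avail N M R P (Suc r)"
  have "(\<Sum>k\<in>past_eager N M R P r x. P k x) \<le> (\<Sum>k\<in>past_eager N M R P (Suc r) x. P k x)"
    using assms x past_eager_subset[of N M R P "Suc r" x]
    by (intro sum_mono2)
      (auto simp: past_eager_Suc avail_iff random_assignment_def intro: finite_subset)
  then show "x \<in> avail N M R P r"
    using x assms(3) by (auto simp: avail_iff)
qed

section \<open>Agreement of \<open>P\<close> with a dominating assignment \<open>Q\<close>\<close>

context
  fixes N :: "'a set" and M :: "'b set" and R :: "('a, 'b) profile"
    and P Q :: "'a \<Rightarrow> 'b \<Rightarrow> real"
  assumes ap: "assignment_problem N M" and pp: "preference_profile N M R"
    and P: "random_assignment N M P" and Q: "random_assignment N M Q"
    and feri: "ea_FERI N M R P"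
    and dom: "\<And>j. j \<in> N \<Longrightarrow> sd_weakly_dominates M (R j) (Q j) (P j)"
begin

private lemma finN: "finite N" and finM: "finite M"
  using ap by (auto simp: assignment_problem_def)

private lemma order: "j \<in> N \<Longrightarrow> strict_linear_order_on M (R j)"
  using pp by (auto simp: preference_profile_def)

private lemma upper_set_subset: "x \<in> M \<Longrightarrow> upper_set M r x \<subseteq> M"
  by (auto simp: upper_set_def)

private lemma eager_upper_unavailable:
  assumes "j \<in> eager N M R P r x" "y \<in> upper_set M (R j) x" "y \<noteq> x"
  shows "y \<in> M - avail N M R P r"
proof -
  have j: "j \<in> N" "x \<in> avail N M R P r" "x = top_item R j (avail N M R P r)"
    using assms(1) by (auto simp: eager_iff)
  have yx: "(y, x) \<in> R j" "y \<in> M" using assms by (auto simp: upper_set_def)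
  have o: "strict_linear_order_on M (R j)" using order j by simp
  have "y \<notin> avail N M R P r"
  proof
    assume "y \<in> avail N M R P r"
    then have "(x, y) \<in> R j"
      using top_item_props(2)[of M R j "avail N M R P r" y] o j assms(3)
        avail_subset[of N M R P r] finite_subset[OF avail_subset finM, of N R P r] by auto
    then show False
      using yx transD[of "R j" x y x] o by (auto simp: strict_linear_order_on_def irrefl_def)
  qed
  then show ?thesis using yx by simp
qed

text \<open>The past eager agents already hold the whole column of an exhausted item under
  \<open>P\<close>. By the entrywise bound they hold at least as much under \<open>Q\<close>, whose
  column sum is also 1. So the bound is tight on these agents, and both columns vanish
  elsewhere.\<close>

private lemma column_eq:
  assumes "x \<in> M - avail N M R P r" "r \<noteq> 0" "\<And>j. j \<in> past_eager N M R P r x \<Longrightarrow> P j x \<le> Q j x"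
    and "j \<in> N"
  shows "Q j x = P j x"
proof -
  let ?E = "past_eager N M R P r x"
  have E: "?E \<subseteq> N" "finite ?E"
    using past_eager_subset finN finite_subset by metis+
  have ge: "1 \<le> (\<Sum>k\<in>?E. P k x)" and x: "x \<in> M"
    using assms by (auto simp: avail_iff)
  have le: "(\<Sum>k\<in>?E. P k x) \<le> (\<Sum>k\<in>?E. Q k x)"
    using assms(3) by (rule sum_mono)
  have cP: "\<And>k. k \<in> N \<Longrightarrow> 0 \<le> P k x" "(\<Sum>k\<in>N. P k x) = 1"
    and cQ: "\<And>k. k \<in> N \<Longrightarrow> 0 \<le> Q k x" "(\<Sum>k\<in>N. Q k x) = 1"
    using P Q x by (auto simp: random_assignment_def)
  show ?thesis
  proof (cases "j \<in> ?E")
    case True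
    have "(\<Sum>k\<in>?E. Q k x) \<le> (\<Sum>k\<in>N. Q k x)"
      using E finN cQ by (intro sum_mono2) auto
    then show ?thesis
      using sum_eq_imp_eq_of_le[of ?E "\<lambda>k. P k x" "\<lambda>k. Q k x" j] E assms(3) ge cQ True by simp
  next
    case False
    have "P j x = 0"
      by (rule eq_zero_of_sum_subset[of N ?E]) (use finN E cP ge assms(4) False in auto)
    moreover have "Q j x = 0"
      by (rule eq_zero_of_sum_subset[of N ?E]) (use finN E cQ ge le assms(4) False in auto)
    ultimately show ?thesis by simp
  qed
qed

text \<open>ea-FERI in round \<open>Suc r\<close> gives the value for \<open>P\<close>; the sum for
  \<open>Q\<close> is squeezed between it, by dominance, and the row sum 1.\<close>

private lemma satisfied_sum_eq:
  assumes "j \<in> eager N M R P r x" "x \<in> avail N M R P (Suc r)"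
  shows "(\<Sum>y\<in>upper_set M (R j) x. P j y) = 1" "(\<Sum>y\<in>upper_set M (R j) x. Q j y) = 1"
proof -
  have j: "j \<in> N" and x: "x \<in> M" using assms by (auto simp: eager_iff avail_iff)
  show 1: "(\<Sum>y\<in>upper_set M (R j) x. P j y) = 1"
    using feri assms j by (force simp: ea_FERI_def)
  have "(\<Sum>y\<in>upper_set M (R j) x. Q j y) \<le> (\<Sum>y\<in>M. Q j y)"
    using Q j finM upper_set_subset[OF x]
    by (intro sum_mono2) (auto simp: random_assignment_def)
  moreover have "(\<Sum>y\<in>M. Q j y) = 1"
    using Q j by (auto simp: random_assignment_def)
  moreover have "(\<Sum>y\<in>upper_set M (R j) x. P j y) \<le> (\<Sum>y\<in>upper_set M (R j) x. Q j y)"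
    using dom[OF j] x by (auto simp: sd_weakly_dominates_def)
  ultimately show "(\<Sum>y\<in>upper_set M (R j) x. Q j y) = 1"
    using 1 by linarith
qed

private lemma agree_past_eager:
  "j \<in> past_eager N M R P r x \<Longrightarrow> Q j x = P j x"
proof (induction r arbitrary: j x)
  case 0
  then show ?case by (simp add: past_eager_def)
next
  case (Suc r)
  show ?case
  proof (cases "j \<in> past_eager N M R P r x")
    case True
    then show ?thesis by (rule Suc.IH)
  next
    case False
    \<comment> \<open>Shown for every agent eager in this round, not just \<open>j\<close>: if
      \<open>x\<close> is now exhausted, \<open>column_eq\<close> needs the inequality for all past
      eager agents at once.\<close>
    have current_round: "P k x \<le> Q k x \<and> (x \<in> avail N M R P (Suc r) \<longrightarrow> Q k x = P k x)"
      if k: "k \<in> eager N M R P r x" for k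
    proof -
      let ?U = "upper_set M (R k) x"
      have kN: "k \<in> N" and x: "x \<in> M" and r: "r \<noteq> 0"
        using k by (auto simp: eager_iff avail_iff)
      have fin: "finite ?U" "x \<in> ?U"
        using upper_set_subset[OF x] finM finite_subset by (auto simp: upper_set_def)
      \<comment> \<open>Each \<open>y\<close> strictly above \<open>x\<close> was exhausted by round
        \<open>r\<close>, so its column is settled by the induction hypothesis, which therefore
        ranges over all items.\<close>
      have "Q k y = P k y" if "y \<in> ?U - {x}" for y
        using column_eq[of y r k] eager_upper_unavailable[OF k, of y] that r Suc.IH kN by auto
      then have "sum (Q k) (?U - {x}) = sum (P k) (?U - {x})"
        by (rule sum.cong[OF refl])
      \<comment> \<open>Only the entry at \<open>x\<close> is left of the difference: dominance
        makes it nonnegative, and it vanishes when both sums are 1.\<close>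
      then have *: "sum (Q k) ?U - sum (P k) ?U = Q k x - P k x"
        using fin by (simp add: sum.remove[of ?U x])
      moreover have "sum (P k) ?U \<le> sum (Q k) ?U"
        using dom[OF kN] x by (auto simp: sd_weakly_dominates_def)
      ultimately show ?thesis
        using satisfied_sum_eq[OF k] by auto
    qed
    have j: "j \<in> eager N M R P r x" using Suc.prems False by (auto simp: past_eager_Suc)
    show ?thesis
    proof (cases "x \<in> avail N M R P (Suc r)")
      case True
      then show ?thesis using current_round[OF j] by blast
    next
      case False
      have "P k x \<le> Q k x" if "k \<in> past_eager N M R P (Suc r) x" for k
        using that Suc.IH[of k x] current_round[of k] by (auto simp: past_eager_Suc)
      then show ?thesis
        using column_eq[of x "Suc r" j] False j by (auto simp: eager_iff avail_iff)
    qed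
  qed
qed

private lemma agree_unavailable:
  "x \<in> M - avail N M R P r \<Longrightarrow> r \<noteq> 0 \<Longrightarrow> j \<in> N \<Longrightarrow> Q j x = P j x"
  using column_eq agree_past_eager by simp

text \<open>Take a positive round with the fewest available items: the next set is contained in this
  one and cannot be smaller.\<close>

private lemma ex_stationary: "\<exists>r. r \<noteq> 0 \<and> avail N M R P (Suc r) = avail N M R P r"
proof -
  obtain r where r: "r \<noteq> 0" "\<And>s. s \<noteq> 0 \<Longrightarrow> card (avail N M R P r) \<le> card (avail N M R P s)"
    using ex_has_least_nat[of "\<lambda>r. r \<noteq> 0" "Suc 0" "\<lambda>r. card (avail N M R P r)"] by auto
  have "avail N M R P (Suc r) = avail N M R P r"
    by (rule card_seteq)
      (simp_all add: r finite_subset[OF avail_subset finM] avail_Suc_subset[OF finN P])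
  then show ?thesis using r by blast
qed

lemma dominating_eq:
  assumes "j \<in> N" "y \<in> M"
  shows "Q j y = P j y"
proof -
  obtain r where r: "r \<noteq> 0" "avail N M R P (Suc r) = avail N M R P r"
    using ex_stationary by blast
  let ?A = "avail N M R P r"
  show ?thesis
  proof (cases "?A = {}")
    case True
    then show ?thesis using agree_unavailable[of y r j] r assms by simp
  next
    case False
    define x where "x = top_item R j ?A"
    let ?U = "upper_set M (R j) x"
    have xA: "x \<in> ?A"
      unfolding x_def
      by (rule top_item_props(1)[of M])
        (simp_all add: order assms(1) False finite_subset[OF avail_subset finM] avail_subset)
    then have j: "j \<in> eager N M R P r x" using assms by (simp add: eager_iff x_def)
    have U: "?U \<subseteq> M" using xA upper_set_subset[of x] by (simp add: avail_iff)
    \<comment> \<open>Stationarity keeps \<open>x\<close> available in the next round, so ea-FERI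
      applies to \<open>j\<close>.\<close>
    note sat = satisfied_sum_eq[OF j] r(2) xA
    show ?thesis
    proof (cases "y \<in> ?U")
      case True
      show ?thesis
      proof (cases "y = x")
        case True
        then show ?thesis
          using agree_past_eager[of j "Suc r" x] j by (simp add: past_eager_Suc)
      next
        case False
        then show ?thesis
          using eager_upper_unavailable[OF j True] agree_unavailable[of y r j] r assms by simp
      qed
    next
      case False
      \<comment> \<open>All the mass of row \<open>j\<close> lies on \<open>?U\<close>, under
        \<open>P\<close> and under \<open>Q\<close> alike.\<close>
      have "P j y = 0"
        by (rule eq_zero_of_sum_subset[of M ?U])
          (use finM U P assms sat False in \<open>auto simp: random_assignment_def\<close>)
      moreover have "Q j y = 0"
        by (rule eq_zero_of_sum_subset[of M ?U])
          (use finM U Q assms sat False in \<open>auto simp: random_assignment_def\<close>)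
      ultimately show ?thesis by simp
    qed
  qed
qed

end

lemma ea_FERI_imp_sd_PE:
  assumes "assignment_problem N M" "preference_profile N M R" "random_assignment N M P"
    and "ea_FERI N M R P"
  shows "sd_PE N M R P"
  unfolding sd_PE_def using dominating_eq[OF assms(1-3) _ assms(4)] by blast

section \<open>An sd-efficient assignment violating ea-FERI\<close>

definition ex_pref :: "(nat, nat) profile" where
  "ex_pref j = (if j = 2 then {(1, 0), (1, 2), (0, 2)} else {(0, 1), (0, 2), (1, 2)})"

definition ex_assign :: "nat \<Rightarrow> nat \<Rightarrow> real" where
  "ex_assign j x = (if j = x then 1 else 0)"

lemma ex_pref_strict: "strict_linear_order_on {0, 1, 2} (ex_pref j)"
  unfolding strict_linear_order_on_def
proof (intro conjI)
  show "trans (ex_pref j)"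
    by (rule transI) (auto simp: ex_pref_def split: if_splits)
  show "irrefl (ex_pref j)"
    by (rule irreflI) (auto simp: ex_pref_def)
  show "total_on {0, 1, 2} (ex_pref j)"
    by (rule total_onI) (auto simp: ex_pref_def)
qed

lemma ex_preference_profile: "preference_profile {0, 1, 2} {0, 1, 2} ex_pref"
proof -
  have "ex_pref j \<subseteq> {0, 1, 2} \<times> {0, 1, 2}" for j
    by (simp add: ex_pref_def)
  then show ?thesis
    unfolding preference_profile_def using ex_pref_strict by blast
qed

lemma ex_random_assignment: "random_assignment {0, 1, 2} {0, 1, 2} ex_assign"
  by (auto simp: random_assignment_def ex_assign_def)

lemma ex_upper_sets:
  "upper_set {0, 1, 2} (ex_pref 0) 0 = {0}"
  "upper_set {0, 1, 2} (ex_pref 1) 1 = {0, 1}"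
  "upper_set {0, 1, 2} (ex_pref 2) 1 = {1}"
  by (auto simp: upper_set_def ex_pref_def)

lemma ex_sd_PE: "sd_PE {0, 1, 2} {0, 1, 2} ex_pref ex_assign"
proof -
  let ?I = "{0, 1, 2} :: nat set"
  have "\<forall>j\<in>?I. \<forall>x\<in>?I. Q j x = ex_assign j x"
    if Q: "random_assignment ?I ?I Q"
      and dom: "\<forall>j\<in>?I. sd_weakly_dominates ?I (ex_pref j) (Q j) (ex_assign j)" for Q
  proof -
    have nn: "\<And>j x. j \<in> ?I \<Longrightarrow> x \<in> ?I \<Longrightarrow> 0 \<le> Q j x"
      using Q unfolding random_assignment_def by blast
    have rows: "\<And>j. j \<in> ?I \<Longrightarrow> Q j 0 + (Q j 1 + Q j 2) = 1"
      and cols: "\<And>x. x \<in> ?I \<Longrightarrow> Q 0 x + (Q 1 x + Q 2 x) = 1"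
      using Q by (auto simp: random_assignment_def)
    have "(\<Sum>y\<in>upper_set ?I (ex_pref 0) 0. ex_assign 0 y) \<le> (\<Sum>y\<in>upper_set ?I (ex_pref 0) 0. Q 0 y)"
      "(\<Sum>y\<in>upper_set ?I (ex_pref 1) 1. ex_assign 1 y) \<le> (\<Sum>y\<in>upper_set ?I (ex_pref 1) 1. Q 1 y)"
      using dom unfolding sd_weakly_dominates_def by blast+
    \<comment> \<open>The first bound gives agent 0 all of item 0. Column 0 then leaves none of it
      to agent 1, whom the second bound thus gives all of item 1; the remaining row and column sums
      fix agent 2.\<close>
    then have "1 \<le> Q 0 0" "1 \<le> Q 1 0 + Q 1 1"
      by (simp_all only: ex_upper_sets) (simp_all add: ex_assign_def)
    moreover have "0 \<le> Q 0 1" "0 \<le> Q 0 2" "0 \<le> Q 1 0" "0 \<le> Q 1 2" "0 \<le> Q 2 0" "0 \<le> Q 2 1"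
      by (simp_all add: nn)
    moreover note rows[of 0] rows[of 1] rows[of 2] cols[of 0] cols[of 1] cols[of 2]
    ultimately show ?thesis
      by (simp add: ex_assign_def)
  qed
  then show ?thesis unfolding sd_PE_def by blast
qed

lemma ex_not_ea_FERI: "\<not> ea_FERI {0, 1, 2} {0, 1, 2} ex_pref ex_assign"
proof
  let ?I = "{0, 1, 2} :: nat set"
  assume feri: "ea_FERI ?I ?I ex_pref ex_assign"
  have top: "top_item ex_pref j ?I = (if j = 2 then 1 else 0)" for j
    by (rule top_item_eqI[where R = ex_pref, OF ex_pref_strict]) (auto simp: ex_pref_def split: if_splits)
  have e: "eager ?I ?I ex_pref ex_assign (Suc 0) 1 = {2}"
    by (auto simp only: eager_iff avail_one top split: if_splits)
  \<comment> \<open>Agent 2 holds none of item 1 under \<open>ex_assign\<close>, so the item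
    survives round 1.\<close>
  then have "1 \<in> avail ?I ?I ex_pref ex_assign (Suc (Suc 0))"
    by (simp add: avail_iff past_eager_Suc[of _ _ _ _ "Suc 0"] past_eager_one ex_assign_def)
  moreover have "\<exists>r'<Suc (Suc 0). 2 \<in> eager ?I ?I ex_pref ex_assign r' 1"
    using e by blast
  ultimately have "(\<Sum>y\<in>upper_set ?I (ex_pref 2) 1. ex_assign 2 y) = 1"
    using feri[unfolded ea_FERI_def, rule_format, of "Suc (Suc 0)" 1 2] by simp
  then show False
    unfolding ex_upper_sets by (simp add: ex_assign_def)
qed

theorem proposition3:
  shows "(\<forall>(N :: 'a set) (M :: 'b set) R P.
            assignment_problem N M \<longrightarrow> preference_profile N M R \<longrightarrow> random_assignment N M P \<longrightarrow>
            ea_FERI N M R P \<longrightarrow> sd_PE N M R P) \<and>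
         (\<exists>(N :: nat set) (M :: nat set) R P.
            assignment_problem N M \<and> preference_profile N M R \<and> random_assignment N M P \<and>
            sd_PE N M R P \<and> \<not> ea_FERI N M R P)"
proof (intro conjI)
  show "\<exists>(N :: nat set) (M :: nat set) R P.
          assignment_problem N M \<and> preference_profile N M R \<and> random_assignment N M P \<and>
          sd_PE N M R P \<and> \<not> ea_FERI N M R P"
    using ex_preference_profile ex_random_assignment ex_sd_PE ex_not_ea_FERI
    by (intro exI[of _ "{0, 1, 2}"] exI[of _ ex_pref] exI[of _ ex_assign])
      (auto simp: assignment_problem_def)
qed (use ea_FERI_imp_sd_PE in blast)

end
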